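(* For integers $0\le k\le m\le n$, there is a bijection between the set of free Schröder paths of length $2n$ with $m$ flaws in $k$ flaw blocks and the set of leaf-colored doubly rooted plane trees with $n$ edges, stem size $k$ and $m$ prefix edges.
   Context: A free Schröder path of length $2n$ is a lattice path from $(0,0)$ to $(2n,0)$ with steps $U=(1,1)$, $H=(2,0)$, $D=(1,-1)$. It has $m$ flaws if the total number of $U$ steps and $H$ steps lying below the $x$-axis (a $U$ step from height $-j$ to $-j+1$, or an $H$ step at height $-j$, with $j\ge1$) equals $m$. A flaw block is a maximal segment that starts and ends on the $x$-axis and is otherwise strictly below it (a negative elevated Schröder path); their number equals the number of $D$ steps from height $0$ to $-1$. A plane tree is a rooted tree with ordered children; a leaf is a non-root vertex with no children. A leaf-colored doubly rooted plane tree is a plane tree with a distinguished vertex $w$ in which every leaf other than $w$ is colored red or blue. The stem is the path from the root to $w$, and the stem size is its number of edges. Label vertices $0,\dots,n$ in right-to-left preorder (root first, then the subtrees of the root recursively from rightmost to leftmost); an edge is a prefix edge if it is on the stem or to the right of the stem, equivalently if its lower endpoint has label at most the label of $w$. *)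

theory Defs
  imports Main "HOL-Library.Sublist"
begin

section \<open>Free Schroeder paths\<close>

datatype step = Up | Hor | Down

fun dx :: "step \<Rightarrow> nat" where
  "dx Up = 1" | "dx Hor = 2" | "dx Down = 1"

fun dy :: "step \<Rightarrow> int" where
  "dy Up = 1" | "dy Hor = 0" | "dy Down = -1"

text \<open>The height after the first \<open>i\<close> steps, i.e. the height at which the step \<open>p ! i\<close> starts.\<close>

definition height :: "step list \<Rightarrow> nat \<Rightarrow> int" where
  "height p i = (\<Sum>s\<leftarrow>take i p. dy s)"

definition free_schroeder_paths :: "nat \<Rightarrow> step list set" where
  "free_schroeder_paths n = {p. (\<Sum>s\<leftarrow>p. dx s) = 2 * n \<and> (\<Sum>s\<leftarrow>p. dy s) = 0}"

definition flaws :: "step list \<Rightarrow> nat set" where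
  "flaws p = {i. i < length p \<and> (p ! i = Up \<or> p ! i = Hor) \<and> height p i < 0}"

text \<open>
  A flaw block is given by the pair of indices of its first and its last lattice point.
  The condition \<open>i + 1 < j\<close> rules out a single \<open>Hor\<close> step on the axis, which has no inner
  lattice point in this encoding. Such a segment is automatically maximal, since any larger
  one would contain one of its end points, of height 0, in the interior.
\<close>

definition flaw_blocks :: "step list \<Rightarrow> (nat \<times> nat) set" where
  "flaw_blocks p = {(i, j). i + 1 < j \<and> j \<le> length p \<and> height p i = 0 \<and> height p j = 0 \<and>
     (\<forall>l. i < l \<and> l < j \<longrightarrow> height p l < 0)}"

definition flawed_paths :: "nat \<Rightarrow> nat \<Rightarrow> nat \<Rightarrow> step list set" where
  "flawed_paths n m k =
     {p \<in> free_schroeder_paths n. card (flaws p) = m \<and> card (flaw_blocks p) = k}"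


section \<open>Leaf-colored doubly rooted plane trees\<close>

datatype plane_tree = Node "plane_tree list"

text \<open>
  A vertex is represented by the list of child indices, counted from left to right starting
  with 0, that leads from the root to it. An edge is represented by its lower endpoint.
\<close>

fun is_vertex :: "plane_tree \<Rightarrow> nat list \<Rightarrow> bool" where
  "is_vertex t [] = True"
| "is_vertex (Node ts) (i # v) = (i < length ts \<and> is_vertex (ts ! i) v)"

definition vertices :: "plane_tree \<Rightarrow> nat list set" where
  "vertices t = {v. is_vertex t v}"

definition edges :: "plane_tree \<Rightarrow> nat list set" where
  "edges t = vertices t - {[]}"

definition leaves :: "plane_tree \<Rightarrow> nat list set" where
  "leaves t = {v \<in> vertices t. v \<noteq> [] \<and> (\<forall>i. v @ [i] \<notin> vertices t)}"

definition stem_edges :: "nat list \<Rightarrow> nat list set" where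
  "stem_edges w = {v. v \<noteq> [] \<and> prefix v w}"

definition stem_size :: "nat list \<Rightarrow> nat" where
  "stem_size w = card (stem_edges w)"

definition right_of :: "nat list \<Rightarrow> nat list \<Rightarrow> bool" where
  "right_of v w \<longleftrightarrow> (\<exists>u i j v' w'. v = u @ i # v' \<and> w = u @ j # w' \<and> j < i)"

definition prefix_edges :: "plane_tree \<Rightarrow> nat list \<Rightarrow> nat list set" where
  "prefix_edges t w = {v \<in> edges t. v \<in> stem_edges w \<or> right_of v w}"

datatype color = Red | Blue

text \<open>In a triple \<open>(t, w, c)\<close>, the partial map \<open>c\<close> colors exactly the leaves of \<open>t\<close> other than \<open>w\<close>.\<close>

definition colored_doubly_rooted_trees ::
    "(plane_tree \<times> nat list \<times> (nat list \<Rightarrow> color option)) set" where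
  "colored_doubly_rooted_trees = {(t, w, c). w \<in> vertices t \<and> dom c = leaves t - {w}}"

definition stemmed_trees ::
    "nat \<Rightarrow> nat \<Rightarrow> nat \<Rightarrow> (plane_tree \<times> nat list \<times> (nat list \<Rightarrow> color option)) set" where
  "stemmed_trees n m k = {(t, w, c) \<in> colored_doubly_rooted_trees.
     card (edges t) = n \<and> stem_size w = k \<and> card (prefix_edges t w) = m}"


section \<open>Prefix edges in terms of the right-to-left preorder\<close>

fun rl_preorder :: "plane_tree \<Rightarrow> nat list list" where
  "rl_preorder (Node ts) =
     [] # concat (rev (map (\<lambda>(i, vs). map ((#) i) vs) (enumerate 0 (map rl_preorder ts))))"

definition label :: "plane_tree \<Rightarrow> nat list \<Rightarrow> nat" where
  "label t v = length (takeWhile (\<lambda>u. u \<noteq> v) (rl_preorder t))"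

lemma right_of_Nil [simp]: "\<not> right_of [] w" "\<not> right_of v []"
  by (auto simp: right_of_def)

lemma right_of_Cons [simp]:
  "right_of (i # v) (j # w) \<longleftrightarrow> j < i \<or> (i = j \<and> right_of v w)"
proof
  assume "right_of (i # v) (j # w)"
  then obtain u a b v' w' where *: "i # v = u @ a # v'" "j # w = u @ b # w'" "b < a"
    by (auto simp: right_of_def)
  show "j < i \<or> (i = j \<and> right_of v w)"
  proof (cases u)
    case Nil
    then show ?thesis using * by auto
  next
    case (Cons x u')
    then have "i = j" "v = u' @ a # v'" "w = u' @ b # w'" using * by auto
    then show ?thesis using \<open>b < a\<close> unfolding right_of_def by blast
  qed
next
  assume "j < i \<or> (i = j \<and> right_of v w)"
  then show "right_of (i # v) (j # w)"
  proof
    assume "j < i"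
    then show ?thesis unfolding right_of_def
      by (intro exI[of _ "[]"] exI[of _ i] exI[of _ j] exI[of _ v] exI[of _ w]) auto
  next
    assume "i = j \<and> right_of v w"
    then obtain u a b v' w' where "i = j" "v = u @ a # v'" "w = u @ b # w'" "b < a"
      by (auto simp: right_of_def)
    then show ?thesis unfolding right_of_def
      by (intro exI[of _ "i # u"] exI[of _ a] exI[of _ b] exI[of _ v'] exI[of _ w']) auto
  qed
qed

lemma set_rl_preorder: "set (rl_preorder t) = vertices t"
proof (induction t)
  case (Node ts)
  have *: "v \<in> set (rl_preorder (ts ! i)) \<longleftrightarrow> is_vertex (ts ! i) v" if "i < length ts" for i v
    using Node[of "ts ! i"] that by (auto simp: vertices_def)
  have "set (enumerate 0 (map rl_preorder ts)) = (\<lambda>i. (i, rl_preorder (ts ! i))) ` {..<length ts}"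
    by (auto simp: in_set_enumerate_eq image_iff)
  then have "v \<in> set (rl_preorder (Node ts)) \<longleftrightarrow> is_vertex (Node ts) v" for v
    by (cases v) (auto simp: * image_iff)
  then show ?case unfolding vertices_def by blast
qed

definition rl_before :: "nat list \<Rightarrow> nat list \<Rightarrow> bool" where
  "rl_before v w \<longleftrightarrow> strict_prefix v w \<or> right_of v w"

lemma rl_before_simps [simp]:
  "\<not> rl_before v []" "rl_before [] (j # w)"
  "rl_before (i # v) (j # w) \<longleftrightarrow> j < i \<or> (i = j \<and> rl_before v w)"
  by (auto simp: rl_before_def)

lemma rl_before_asym: "rl_before v w \<Longrightarrow> \<not> rl_before w v"
proof (induction v arbitrary: w)
  case Nil
  then show ?case by simp
next
  case (Cons i v)
  then show ?case by (cases w) auto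
qed

lemma sorted_concat_rev_enumerate:
  assumes "\<And>vs. vs \<in> set vss \<Longrightarrow> sorted_wrt rl_before vs"
  shows "sorted_wrt rl_before
           (concat (rev (map (\<lambda>(i, vs). map ((#) i) vs) (enumerate k vss))))"
  using assms
proof (induction vss arbitrary: k)
  case Nil
  then show ?case by simp
next
  case (Cons vs vss)
  then show ?case
    by (fastforce simp: sorted_wrt_append sorted_wrt_map in_set_enumerate_eq)
qed

lemma sorted_rl_preorder: "sorted_wrt rl_before (rl_preorder t)"
proof (induction t)
  case (Node ts)
  then have "sorted_wrt rl_before
      (concat (rev (map (\<lambda>(i, vs). map ((#) i) vs) (enumerate 0 (map rl_preorder ts)))))"
    by (intro sorted_concat_rev_enumerate) auto
  then show ?case by auto
qed

lemma length_takeWhile_le_iff: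
  assumes "sorted_wrt rl_before xs" "v \<in> set xs" "w \<in> set xs"
  shows "length (takeWhile (\<lambda>u. u \<noteq> v) xs) \<le> length (takeWhile (\<lambda>u. u \<noteq> w) xs) \<longleftrightarrow>
         v = w \<or> rl_before v w"
  using assms
  by (induction xs) (auto dest: rl_before_asym)

lemma prefix_edges_eq_label:
  assumes "w \<in> vertices t"
  shows "prefix_edges t w = {v \<in> edges t. label t v \<le> label t w}"
proof -
  have "label t v \<le> label t w \<longleftrightarrow> v = w \<or> rl_before v w" if "v \<in> edges t" for v
    unfolding label_def using that assms
    by (intro length_takeWhile_le_iff sorted_rl_preorder) (auto simp: set_rl_preorder edges_def)
  then show ?thesis
    by (auto simp: prefix_edges_def stem_edges_def rl_before_def edges_def strict_prefix_def)
qed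

end

theory Submission
  imports Defs
begin

text \<open>
  Both sides are encoded by the same data. Cutting a free Schroeder path at its flaw blocks
  leaves \<open>k + 1\<close> nonnegative Schroeder paths, separated by \<open>k\<close> negative elevated ones. Cutting
  a doubly rooted tree along its stem leaves \<open>k + 1\<close> leaf-colored forests to the left (the last
  one being the forest below \<open>w\<close>) and \<open>k\<close> to the right. Finally, leaf-colored forests with
  \<open>n\<close> edges correspond to Schroeder paths of length \<open>2 n\<close>: red leaves are the \<open>Hor\<close> steps and all
  other vertices are the matched pairs of an \<open>Up\<close> and a \<open>Down\<close> step.
\<close>

section \<open>Leaf-colored forests\<close>

text \<open>\<open>Inner []\<close> is a blue leaf.\<close>

datatype colored_tree = Red_Leaf | Inner "colored_tree list"

text \<open>An edge is counted at its lower endpoint, so the edges joining the roots of the forest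
  to their common parent are included.\<close>

fun forest_size :: "colored_tree list \<Rightarrow> nat" where
  "forest_size [] = 0"
| "forest_size (Red_Leaf # ts) = Suc (forest_size ts)"
| "forest_size (Inner us # ts) = Suc (forest_size us + forest_size ts)"

text \<open>Each pair \<open>(a, b)\<close> stands for one flaw block or stem edge: \<open>a\<close>
  is the path before the block or the forest left of the stem, \<open>b\<close> the inside of the
  block or the forest right of the stem. The final \<open>s\<close> is the last nonnegative path or
  the forest below \<open>w\<close>.\<close>

type_synonym code = "(colored_tree list \<times> colored_tree list) list \<times> colored_tree list"

text \<open>Each \<open>Suc\<close> accounts for the stem edge itself, or for the
  \<open>Down\<close> and \<open>Up\<close> enclosing a flaw block; that \<open>Up\<close> starts at
  height -1 and is a flaw.\<close>

definition codes :: "nat \<Rightarrow> nat \<Rightarrow> nat \<Rightarrow> code set" where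
  "codes n m k = {(xs, s). length xs = k \<and> (\<Sum>(a, b)\<leftarrow>xs. Suc (forest_size b)) = m \<and>
     (\<Sum>(a, b)\<leftarrow>xs. Suc (forest_size a + forest_size b)) + forest_size s = n}"


section \<open>Encoding of free paths\<close>

text \<open>The two steps are parameters so that nonnegative paths (\<open>Up\<close>,
  \<open>Down\<close>) and their mirror images inside flaw blocks (\<open>Down\<close>,
  \<open>Up\<close>) share one encoding.\<close>

fun word :: "step \<Rightarrow> step \<Rightarrow> colored_tree list \<Rightarrow> step list" where
  "word u d [] = []"
| "word u d (Red_Leaf # ts) = Hor # word u d ts"
| "word u d (Inner us # ts) = u # word u d us @ d # word u d ts"

fun path_of :: "code \<Rightarrow> step list" where
  "path_of ([], s) = word Up Down s"
| "path_of ((a, b) # xs, s) = word Up Down a @ Down # word Down Up b @ Up # path_of (xs, s)"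

section \<open>Unique parsing of words and paths\<close>

text \<open>Reading from the left, \<open>Hor\<close> and \<open>u\<close> continue the forest,
  while an unmatched \<open>d\<close> or the end of the list stops it, so the cut point is
  forced.\<close>

lemma word_append_unique:
  assumes "word u d a @ x = word u d b @ y" "u \<noteq> d" "u \<noteq> Hor" "d \<noteq> Hor"
    and "x = [] \<or> hd x = d" "y = [] \<or> hd y = d"
  shows "a = b \<and> x = y"
  using assms
proof (induction u d a arbitrary: b x y rule: word.induct)
  case (1 u d)
  then show ?case by (cases "(u, d, b)" rule: word.cases) auto
next
  case (2 u d ts)
  show ?case
  proof (cases "(u, d, b)" rule: word.cases)
    case (2 u' d' ts')
    then show ?thesis using "2.prems" "2.IH"[of x ts' y] by auto
  qed (use "2.prems" in auto)
next
  case (3 u d us ts)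
  show ?case
  proof (cases "(u, d, b)" rule: word.cases)
    case (3 u' d' us' ts')
    then have "us = us' \<and> d # word u d ts @ x = d # word u d ts' @ y"
      using "3.prems" by (intro "3.IH"(1)) auto
    then show ?thesis using "3.prems" "3.IH"(2)[of x ts' y] 3 by auto
  qed (use "3.prems" in auto)
qed

lemma path_of_inject: "path_of p = path_of q \<Longrightarrow> p = q"
proof (induction p arbitrary: q rule: path_of.induct)
  case (1 s)
  show ?case
  proof (cases q rule: path_of.cases)
    case (1 s')
    then show ?thesis using "1.prems" word_append_unique[of Up Down s "[]" s' "[]"] by simp
  next
    case (2 a b xs s')
    then show ?thesis using "1.prems" word_append_unique[of Up Down s "[]" a] by force
  qed
next
  case (2 a b xs s)
  show ?case
  proof (cases q rule: path_of.cases)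
    case (1 s')
    then show ?thesis using "2.prems" word_append_unique[of Up Down a _ s' "[]"] by force
  next
    case q: (2 a' b' xs' s')
    \<comment> \<open>Both parses stop at the first \<open>Down\<close> below the axis; inside the
      block the roles of \<open>Up\<close> and \<open>Down\<close> are exchanged.\<close>
    have "a = a' \<and> Down # word Down Up b @ Up # path_of (xs, s) =
        Down # word Down Up b' @ Up # path_of (xs', s')"
      using "2.prems" q by (intro word_append_unique[of Up Down]) auto
    moreover from this have "b = b' \<and> Up # path_of (xs, s) = Up # path_of (xs', s')"
      by (intro word_append_unique[of Down Up]) auto
    ultimately show ?thesis using "2.IH"[of "(xs', s')"] q by auto
  qed
qed

section \<open>Existence of a parse\<close>

abbreviation rise :: "step list \<Rightarrow> int" where
  "rise p \<equiv> (\<Sum>s\<leftarrow>p. dy s)"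

lemma rise_word: "dy u + dy d = 0 \<Longrightarrow> rise (word u d ts) = 0"
  by (induction u d ts rule: word.induct) auto

lemma rise_path_of: "rise (path_of c) = 0"
  by (induction c rule: path_of.induct) (auto simp: rise_word)

text \<open>Greedy parsing: the sign condition on the total rise guarantees that every
  \<open>u\<close> met on the way has a matching \<open>d\<close>. The induction is on length
  because parsing resumes after that \<open>d\<close>.\<close>

lemma word_append_exists:
  assumes "dy u * rise p \<le> 0" "(u, d) \<in> {(Up, Down), (Down, Up)}"
  shows "\<exists>s x. p = word u d s @ x \<and> (x = [] \<or> hd x = d)"
  using assms(1)
proof (induction p rule: length_induct)
  case (1 p)
  show ?case
  proof (cases p)
    case Nil
    then show ?thesis by (metis append_Nil word.simps(1))
  next
    case (Cons s p')
    consider "s = Hor" | "s = d" | "s = u" using assms(2) by (cases s) auto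
    then show ?thesis
    proof cases
      case 1
      then obtain s' x where "p' = word u d s' @ x" "x = [] \<or> hd x = d"
        using "1.IH" "1.prems" Cons by force
      then show ?thesis using Cons 1
        by (intro exI[of _ "Red_Leaf # s'"] exI[of _ x]) simp
    next
      case 2
      then show ?thesis using Cons by (intro exI[of _ "[]"] exI[of _ p]) simp
    next
      case 3
      \<comment> \<open>After the \<open>u\<close>, the rest must fall by at least one in direction
        \<open>u\<close>, and a word has rise 0. So what follows \<open>a\<close> is nonempty and
        begins with the matching \<open>d\<close>.\<close>
      have le: "dy u * rise p' \<le> -1" using "1.prems" Cons 3 assms(2) by (auto simp: algebra_simps)
      then obtain a x where ax: "p' = word u d a @ x" "x = [] \<or> hd x = d"
        using "1.IH" Cons by force
      have rx: "dy u * rise x \<le> -1" using le ax rise_word[of u d a] assms(2) by auto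
      then obtain x' where x': "x = d # x'" using ax by (cases x) auto
      have "dy u * rise x' \<le> 0" using rx x' assms(2) by auto
      moreover have "length x' < length p" using Cons ax x' by simp
      ultimately obtain b y where "x' = word u d b @ y" "y = [] \<or> hd y = d"
        using "1.IH" by blast
      then show ?thesis using Cons 3 ax x'
        by (intro exI[of _ "Inner a # b"] exI[of _ y]) simp
    qed
  qed
qed

lemma path_of_surj: "rise p = 0 \<Longrightarrow> \<exists>c. p = path_of c"
proof (induction p rule: length_induct)
  case (1 p)
  obtain a x where ax: "p = word Up Down a @ x" "x = [] \<or> hd x = Down"
    using word_append_exists[of Up p Down] "1.prems" by auto
  show ?case
  proof (cases x)
    case Nil
    then show ?thesis using ax by (intro exI[of _ "([], a)"]) simp
  next
    case (Cons s x')
    then have s: "s = Down" using ax by simp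
    \<comment> \<open>Total rise 1 satisfies the sign condition for the swapped roles. Since
      \<open>b\<close> contributes nothing to it, an \<open>Up\<close> back to the axis must
      follow.\<close>
    have r: "rise x' = 1" using "1.prems" ax Cons s rise_word[of Up Down a] by simp
    then obtain b y where bw: "x' = word Down Up b @ y" "y = [] \<or> hd y = Up"
      using word_append_exists[of Down x' Up] by auto
    have "rise y = 1" using r bw rise_word[of Down Up b] by simp
    then obtain y' where y': "y = Up # y'" "rise y' = 0" using bw by (cases y) auto
    then obtain xs s' where "y' = path_of (xs, s')" using "1.IH" ax Cons bw by force
    then show ?thesis using ax Cons s bw y' by (intro exI[of _ "((a, b) # xs, s')"]) simp
  qed
qed

section \<open>Length, flaws and flaw blocks of an encoded path\<close>

lemma dx_word: "dx u + dx d = 2 \<Longrightarrow> (\<Sum>s\<leftarrow>word u d ts. dx s) = 2 * forest_size ts"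
  by (induction u d ts rule: word.induct) auto

lemma dx_path_of:
  "(\<Sum>s\<leftarrow>path_of (xs, s). dx s) =
     2 * ((\<Sum>(a, b)\<leftarrow>xs. Suc (forest_size a + forest_size b)) + forest_size s)"
  by (induction "(xs, s)" arbitrary: xs rule: path_of.induct) (auto simp: dx_word)

text \<open>Carrying the starting height along turns both statistics into counts that are additive
  under concatenation.\<close>

fun count_steps :: "(step \<Rightarrow> int \<Rightarrow> bool) \<Rightarrow> int \<Rightarrow> step list \<Rightarrow> nat" where
  "count_steps Q h [] = 0"
| "count_steps Q h (s # p) = of_bool (Q s h) + count_steps Q (h + dy s) p"

lemma count_steps_append [simp]:
  "count_steps Q h (p @ q) = count_steps Q h p + count_steps Q (h + rise p) q"
  by (induction p arbitrary: h) (auto simp: algebra_simps)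

lemma card_steps:
  "card {i. i < length p \<and> Q (p ! i) (h + height p i)} = count_steps Q h p"
proof (induction p arbitrary: h)
  case Nil
  then show ?case by simp
next
  case (Cons s p)
  let ?A = "{i. i < length p \<and> Q (p ! i) (h + dy s + height p i)}"
  have "{i. i < length (s # p) \<and> Q ((s # p) ! i) (h + height (s # p) i)} =
      (if Q s h then {0} else {}) \<union> Suc ` ?A" (is "?L = ?R")
  proof (rule set_eqI)
    fix i
    show "i \<in> ?L \<longleftrightarrow> i \<in> ?R" by (cases i) (auto simp: height_def algebra_simps)
  qed
  moreover have "card ?R = of_bool (Q s h) + card ?A"
    by (subst card_Un_disjoint) (auto simp: card_image)
  ultimately show ?case using Cons.IH[of "h + dy s"] by simp
qed

lemma card_flaws:
  "card (flaws p) = count_steps (\<lambda>s h. s \<noteq> Down \<and> h < 0) 0 p"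
proof -
  have "s = Up \<or> s = Hor \<longleftrightarrow> s \<noteq> Down" for s by (cases s) auto
  then show ?thesis unfolding card_steps[symmetric] flaws_def by simp
qed

lemma height_Suc: "i < length p \<Longrightarrow> height p (Suc i) = height p i + dy (p ! i)"
  by (simp add: height_def take_Suc_conv_app_nth)

text \<open>A block is determined by its left end, and the left ends are exactly the starting points
  of the \<open>Down\<close> steps from the axis.\<close>

lemma card_flaw_blocks:
  assumes "rise p = 0"
  shows "card (flaw_blocks p) = count_steps (\<lambda>s h. s = Down \<and> h = 0) 0 p"
proof -
  let ?A = "{i. i < length p \<and> p ! i = Down \<and> height p i = 0}"
  \<comment> \<open>Of two blocks with the same left end, the longer would contain the right end of
    the shorter, at height 0, in its interior.\<close>
  have "\<not> j < j'" if "(i, j) \<in> flaw_blocks p" "(i, j') \<in> flaw_blocks p" for i j j'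
  proof
    assume "j < j'"
    moreover have "i < j" "height p j = 0" "\<forall>l. i < l \<and> l < j' \<longrightarrow> height p l < 0"
      using that by (simp_all add: flaw_blocks_def)
    ultimately have "height p j < 0" by blast
    then show False using \<open>height p j = 0\<close> by simp
  qed
  then have "inj_on fst (flaw_blocks p)"
    unfolding inj_on_def by (metis linorder_neqE_nat prod.collapse)
  moreover have "fst ` flaw_blocks p = ?A"
  proof (intro equalityI subsetI)
    fix i assume "i \<in> fst ` flaw_blocks p"
    then obtain j where j: "i + 1 < j" "j \<le> length p" "height p i = 0"
      "\<forall>l. i < l \<and> l < j \<longrightarrow> height p l < 0"
      by (auto simp: flaw_blocks_def)
    then have "height p (Suc i) < 0" by auto
    then show "i \<in> ?A" using j height_Suc[of i p] by (cases "p ! i") auto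
  next
    fix i assume i: "i \<in> ?A"
    \<comment> \<open>The right end is the first return to nonnegative height; it exists because the
      whole path ends at height 0.\<close>
    let ?P = "\<lambda>j. i < j \<and> height p j \<ge> 0"
    define j where "j = (LEAST j. ?P j)"
    have ex: "?P (length p)" using i assms by (simp add: height_def)
    have j: "i < j" "height p j \<ge> 0" "j \<le> length p"
      using LeastI[of ?P, OF ex] Least_le[of ?P, OF ex] by (auto simp: j_def)
    have below: "height p l < 0" if "i < l" "l < j" for l
      using not_less_Least[of l ?P] that by (auto simp: j_def)
    have "height p (Suc i) = -1" using i height_Suc[of i p] by simp
    then have j2: "i + 1 < j" using j by (cases "j = Suc i") auto
    obtain l where l: "j = Suc l" using j by (cases j) auto
    \<comment> \<open>A step climbs by at most one, so the first nonnegative height after negative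
      ones is exactly 0.\<close>
    have "height p l < 0" using below l j2 by simp
    moreover have "dy (p ! l) \<le> 1" by (cases "p ! l") auto
    ultimately have "height p j = 0" using j height_Suc[of l p] l by simp
    then have "(i, j) \<in> flaw_blocks p" using i j j2 below by (simp add: flaw_blocks_def)
    then show "i \<in> fst ` flaw_blocks p" by force
  qed
  ultimately show ?thesis
    using card_steps[of p "\<lambda>s h. s = Down \<and> h = 0" 0] card_image by fastforce
qed

text \<open>A word stays on one side of its base level. Below the axis each vertex yields one flaw:
  its \<open>Hor\<close>, or the \<open>Up\<close> of its matched pair.\<close>

lemma count_flaws_word:
  "h \<ge> 0 \<Longrightarrow> count_steps (\<lambda>s h. s \<noteq> Down \<and> h < 0) h (word Up Down ts) = 0"
  "h < 0 \<Longrightarrow> count_steps (\<lambda>s h. s \<noteq> Down \<and> h < 0) h (word Down Up ts) = forest_size ts"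
  by (induction ts arbitrary: h rule: forest_size.induct) (auto simp: rise_word)

text \<open>The \<open>Down\<close> steps start strictly above the base level in the first case and
  at or below it in the second, hence never on the axis.\<close>

lemma count_blocks_word:
  "h \<ge> 0 \<Longrightarrow> count_steps (\<lambda>s h. s = Down \<and> h = 0) h (word Up Down ts) = 0"
  "h < 0 \<Longrightarrow> count_steps (\<lambda>s h. s = Down \<and> h = 0) h (word Down Up ts) = 0"
  by (induction ts arbitrary: h rule: forest_size.induct) (auto simp: rise_word)

lemma card_flaws_path_of:
  "card (flaws (path_of (xs, s))) = (\<Sum>(a, b)\<leftarrow>xs. Suc (forest_size b))"
  unfolding card_flaws
  by (induction "(xs, s)" arbitrary: xs rule: path_of.induct)
    (auto simp: rise_word count_flaws_word)

lemma card_flaw_blocks_path_of: "card (flaw_blocks (path_of (xs, s))) = length xs"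
  unfolding card_flaw_blocks[OF rise_path_of]
  by (induction "(xs, s)" arbitrary: xs rule: path_of.induct)
    (auto simp: rise_word count_blocks_word)

lemma bij_betw_path_of: "bij_betw path_of (codes n m k) (flawed_paths n m k)"
proof (rule bij_betw_imageI)
  show "inj_on path_of (codes n m k)" by (auto intro: inj_onI path_of_inject)
  have "path_of c \<in> flawed_paths n m k \<longleftrightarrow> c \<in> codes n m k" for c
    by (cases c) (auto simp: flawed_paths_def free_schroeder_paths_def codes_def rise_path_of
        dx_path_of card_flaws_path_of card_flaw_blocks_path_of simp del: path_of.simps)
  moreover have "\<exists>c. p = path_of c" if "p \<in> flawed_paths n m k" for p
    using that path_of_surj by (auto simp: flawed_paths_def free_schroeder_paths_def)
  ultimately show "path_of ` codes n m k = flawed_paths n m k" by blast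
qed


section \<open>Encoding of doubly rooted trees\<close>

primrec shape :: "colored_tree \<Rightarrow> plane_tree" where
  "shape Red_Leaf = Node []"
| "shape (Inner ts) = Node (map shape ts)"

text \<open>Joins the colorings of the child subtrees under a new uncolored root.\<close>

fun graft :: "(nat list \<Rightarrow> 'a option) list \<Rightarrow> nat list \<Rightarrow> 'a option" where
  "graft cs [] = None"
| "graft cs (i # v) = (if i < length cs then (cs ! i) v else None)"

text \<open>The empty case is separate since a blue leaf colors its own address, whereas
  \<open>graft []\<close> colors nothing.\<close>

primrec coloring :: "colored_tree \<Rightarrow> nat list \<Rightarrow> color option" where
  "coloring Red_Leaf = [[] \<mapsto> Red]"
| "coloring (Inner ts) = (if ts = [] then [[] \<mapsto> Blue] else graft (map coloring ts))"

fun stem_tree :: "code \<Rightarrow> plane_tree" where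
  "stem_tree ([], s) = Node (map shape s)"
| "stem_tree ((a, b) # xs, s) = Node (map shape a @ stem_tree (xs, s) # map shape b)"

fun stem_vertex :: "code \<Rightarrow> nat list" where
  "stem_vertex ([], s) = []"
| "stem_vertex ((a, b) # xs, s) = length a # stem_vertex (xs, s)"

text \<open>Unlike in \<open>coloring\<close>, an empty \<open>s\<close> gives no color: the vertex
  reached is \<open>w\<close>, which stays uncolored even when it is a leaf.\<close>

fun stem_coloring :: "code \<Rightarrow> nat list \<Rightarrow> color option" where
  "stem_coloring ([], s) = graft (map coloring s)"
| "stem_coloring ((a, b) # xs, s) =
     graft (map coloring a @ stem_coloring (xs, s) # map coloring b)"

definition tree_of :: "code \<Rightarrow> plane_tree \<times> nat list \<times> (nat list \<Rightarrow> color option)" where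
  "tree_of c = (stem_tree c, stem_vertex c, stem_coloring c)"

section \<open>Joining and splitting colorings at the root\<close>

lemma dom_graft: "dom (graft cs) = (\<Union>i<length cs. (#) i ` dom (cs ! i))"
proof (rule set_eqI)
  fix v
  show "v \<in> dom (graft cs) \<longleftrightarrow> v \<in> (\<Union>i<length cs. (#) i ` dom (cs ! i))"
    by (cases v) (auto simp: image_iff split: if_splits)
qed

text \<open>The lengths are compared because grafting cannot see trailing empty maps.\<close>

lemma graft_inject:
  assumes "graft cs = graft ds" "length cs = length ds"
  shows "cs = ds"
proof (rule nth_equalityI)
  fix i assume "i < length cs"
  then have "(cs ! i) v = (ds ! i) v" for v
    using fun_cong[OF assms(1), of "i # v"] assms(2) by simp
  then show "cs ! i = ds ! i" by blast
qed fact

lemma graft_exists: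
  assumes "dom c = (\<Union>i<n. (#) i ` A i)"
  shows "\<exists>cs. length cs = n \<and> graft cs = c \<and> (\<forall>i<n. dom (cs ! i) = A i)"
proof (intro exI conjI allI impI)
  \<comment> \<open>The coloring of child \<open>i\<close> is read off at the addresses starting
    with \<open>i\<close>.\<close>
  let ?cs = "map (\<lambda>i v. c (i # v)) [0..<n]"
  show "length ?cs = n" by simp
  show "graft ?cs = c"
  proof
    fix v
    have "c v = None" if "v \<notin> (\<Union>i<n. (#) i ` A i)" using that assms by blast
    moreover have "v \<notin> (\<Union>i<n. (#) i ` A i)" if "v = [] \<or> hd v \<ge> n" using that by auto
    ultimately have "c v = None" if "v = [] \<or> hd v \<ge> n" using that by blast
    then show "graft ?cs v = c v" by (cases v) simp_all
  qed
  fix i assume i: "i < n"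
  have "v \<in> dom (?cs ! i) \<longleftrightarrow> i # v \<in> dom c" for v using i by (simp add: dom_def)
  moreover have "i # v \<in> dom c \<longleftrightarrow> v \<in> A i" for v using i unfolding assms by auto
  ultimately show "dom (?cs ! i) = A i" by blast
qed

text \<open>
  Unlike \<open>leaves\<close>, this includes a childless root, and therefore it is compatible with passing
  to subtrees. The difference is invisible once \<open>w\<close> is removed.
\<close>

definition childless :: "plane_tree \<Rightarrow> nat list set" where
  "childless t = {v \<in> vertices t. \<forall>i. v @ [i] \<notin> vertices t}"

lemma vertices_Node:
  "vertices (Node ts) = insert [] (\<Union>i<length ts. (#) i ` vertices (ts ! i))"
proof (rule set_eqI)
  fix v
  show "v \<in> vertices (Node ts) \<longleftrightarrow>
      v \<in> insert [] (\<Union>i<length ts. (#) i ` vertices (ts ! i))"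
    by (cases v) (auto simp: vertices_def)
qed

lemma childless_Node:
  "childless (Node ts) =
     (if ts = [] then {[]} else (\<Union>i<length ts. (#) i ` childless (ts ! i)))"
proof (rule set_eqI)
  fix v
  show "v \<in> childless (Node ts) \<longleftrightarrow>
      v \<in> (if ts = [] then {[]} else (\<Union>i<length ts. (#) i ` childless (ts ! i)))"
    by (cases v) (auto simp: childless_def vertices_def)
qed

text \<open>The two sets can differ only at the root, and a childless root is the only vertex, hence
  equal to \<open>w\<close>.\<close>

lemma leaves_remove_eq_childless:
  assumes "w \<in> vertices t"
  shows "leaves t - {w} = childless t - {w}"
proof -
  have "w = []" if "[] \<in> childless t"
  proof (cases t; cases w)
    fix ts i v assume *: "t = Node ts" "w = i # v"
    then have "[] @ [i] \<in> vertices t" using assms by (simp add: vertices_def)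
    then show ?thesis using that unfolding childless_def by blast
  qed simp
  then show ?thesis by (auto simp: leaves_def childless_def)
qed

section \<open>Colored trees as shapes with colorings\<close>

lemma dom_coloring: "dom (coloring t) = childless (shape t)"
  by (induction t) (auto simp: childless_Node dom_graft split: if_splits)

text \<open>Injectivity for single trees is an assumption so that the induction hypothesis of
  \<open>shape_coloring_inject\<close> can supply it.\<close>

lemma forest_inject:
  assumes "map shape ss = map shape ts" "map coloring ss = map coloring ts"
    and "\<And>s t. s \<in> set ss \<Longrightarrow> shape s = shape t \<Longrightarrow> coloring s = coloring t \<Longrightarrow> s = t"
  shows "ss = ts"
  using assms by (induction ss arbitrary: ts) (auto simp: Cons_eq_map_conv)

lemma shape_coloring_inject:
  "shape s = shape t \<Longrightarrow> coloring s = coloring t \<Longrightarrow> s = t"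
proof (induction s arbitrary: t)
  case Red_Leaf
  \<comment> \<open>\<open>Red_Leaf\<close> and \<open>Inner []\<close> have the same shape; the
    color at the address \<open>[]\<close> tells them apart.\<close>
  then show ?case by (cases t) (auto dest: fun_cong[of _ _ "[]"])
next
  case (Inner ss)
  show ?case
  proof (cases t)
    case Red_Leaf
    then show ?thesis using Inner.prems by (auto dest: fun_cong[of _ _ "[]"])
  next
    case t: (Inner ts)
    have len: "length ss = length ts" using Inner.prems t by (auto dest: map_eq_imp_length_eq)
    have "ss = ts"
    proof (cases "ss = []")
      case False
      then have "map coloring ss = map coloring ts"
        using Inner.prems t len by (intro graft_inject) auto
      then show ?thesis using Inner t by (intro forest_inject) auto
    qed (use len in simp)
    then show ?thesis using t by simp
  qed
qed

lemma forest_surj: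
  assumes "length cs = length ts" "\<And>i. i < length ts \<Longrightarrow> dom (cs ! i) = childless (ts ! i)"
    and "\<And>t c. t \<in> set ts \<Longrightarrow> dom c = childless t \<Longrightarrow> \<exists>s. shape s = t \<and> coloring s = c"
  shows "\<exists>ss. map shape ss = ts \<and> map coloring ss = cs"
proof -
  have "\<forall>i\<in>{..<length ts}. \<exists>s. shape s = ts ! i \<and> coloring s = cs ! i"
    using assms by auto
  then obtain f where "\<And>i. i < length ts \<Longrightarrow> shape (f i) = ts ! i \<and> coloring (f i) = cs ! i"
    by (metis lessThan_iff)
  then show ?thesis using assms(1)
    by (intro exI[of _ "map f [0..<length ts]"]) (auto intro: nth_equalityI)
qed

lemma shape_coloring_surj:
  "dom c = childless t \<Longrightarrow> \<exists>s. shape s = t \<and> coloring s = c"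
proof (induction t arbitrary: c)
  case (Node ts)
  show ?case
  proof (cases "ts = []")
    case True
    then have d: "dom c = {[]}" using Node.prems by (simp add: childless_Node)
    then obtain x where "c [] = Some x" by blast
    then have "c = [[] \<mapsto> x]" using d by (auto simp: fun_eq_iff)
    then show ?thesis using True
      by (cases x) (auto intro: exI[of _ Red_Leaf] exI[of _ "Inner []"])
  next
    case False
    then obtain cs where cs: "length cs = length ts" "graft cs = c"
      "\<forall>i<length ts. dom (cs ! i) = childless (ts ! i)"
      using graft_exists[of c "\<lambda>i. childless (ts ! i)" "length ts"] Node.prems by (auto simp: childless_Node)
    then obtain ss where "map shape ss = ts" "map coloring ss = cs"
      using forest_surj[of cs ts] Node.IH by auto
    then show ?thesis using cs False by (intro exI[of _ "Inner ss"]) auto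
  qed
qed

section \<open>Cutting a doubly rooted tree along its stem\<close>

lemma stem_vertex_in_vertices: "stem_vertex c \<in> vertices (stem_tree c)"
  by (induction c rule: stem_tree.induct) (auto simp: vertices_def nth_append)

text \<open>Pushes the deletion of the distinguished vertex into the child on the stem, giving the
  union over children that \<open>graft_exists\<close> expects.\<close>

lemma childless_remove_Cons:
  assumes "j < length ts"
  shows "childless (Node ts) - {j # w} =
    (\<Union>i<length ts. (#) i ` (childless (ts ! i) - (if i = j then {w} else {})))"
  using assms by (auto simp: childless_Node split: if_splits)

lemma dom_stem_coloring:
  "dom (stem_coloring c) = childless (stem_tree c) - {stem_vertex c}"
proof (induction c rule: stem_tree.induct)
  case (1 s)
  then show ?case by (auto simp: dom_graft childless_Node dom_coloring)
next
  case (2 a b xs s)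
  have "dom ((map coloring a @ stem_coloring (xs, s) # map coloring b) ! i) =
      childless ((map shape a @ stem_tree (xs, s) # map shape b) ! i) -
      (if i = length a then {stem_vertex (xs, s)} else {})"
    if "i < length a + Suc (length b)" for i
    using that 2 by (auto simp: nth_append nth_Cons' dom_coloring)
  then show ?case by (simp add: dom_graft childless_remove_Cons)
qed

lemma tree_of_inject: "tree_of c = tree_of d \<Longrightarrow> c = d"
proof (induction c arbitrary: d rule: stem_tree.induct)
  case (1 s)
  then obtain s' where d: "d = ([], s')"
    by (cases d rule: stem_tree.cases) (auto simp: tree_of_def)
  with 1 have "map shape s = map shape s'" by (simp add: tree_of_def)
  moreover from this have "map coloring s = map coloring s'"
    using 1 d by (intro graft_inject) (auto simp: tree_of_def dest: map_eq_imp_length_eq)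
  ultimately have "s = s'" by (intro forest_inject shape_coloring_inject)
  then show ?case using d by simp
next
  case (2 a b xs s)
  then obtain a' b' xs' s' where d: "d = ((a', b') # xs', s')"
    by (cases d rule: stem_tree.cases) (auto simp: tree_of_def)
  \<comment> \<open>The first entry of the stem vertex fixes where the two lists of children are
    cut.\<close>
  have len: "length a = length a'" using 2 d by (simp add: tree_of_def)
  then have sh: "map shape a = map shape a'" "stem_tree (xs, s) = stem_tree (xs', s')"
    "map shape b = map shape b'"
    using 2 d by (auto simp: tree_of_def)
  have "length b = length b'" using map_eq_imp_length_eq[OF sh(3)] .
  then have "map coloring a @ stem_coloring (xs, s) # map coloring b =
      map coloring a' @ stem_coloring (xs', s') # map coloring b'"
    using 2 d len by (intro graft_inject) (auto simp: tree_of_def)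
  then have co: "map coloring a = map coloring a'"
    "stem_coloring (xs, s) = stem_coloring (xs', s')" "map coloring b = map coloring b'"
    using len by auto
  have "a = a'" "b = b'" using sh co by (auto intro!: forest_inject shape_coloring_inject)
  moreover have "(xs, s) = (xs', s')"
    using "2.IH"[of "(xs', s')"] "2.prems" sh co d by (simp add: tree_of_def)
  ultimately show ?case using d by simp
qed

text \<open>Induction along the stem: the children of the root split at the next stem index
  \<open>j\<close> into left forest, stem subtree and right forest.\<close>

lemma tree_of_surj:
  "w \<in> vertices t \<Longrightarrow> dom c = childless t - {w} \<Longrightarrow> \<exists>x. tree_of x = (t, w, c)"
proof (induction w arbitrary: t c)
  case Nil
  obtain ts where t: "t = Node ts" by (cases t)
  \<comment> \<open>Deleting the root matters only for the one-vertex tree, where both sides become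
    empty.\<close>
  have "dom c = (\<Union>i<length ts. (#) i ` childless (ts ! i))"
    using Nil t by (auto simp: childless_Node split: if_splits)
  then obtain cs where cs: "length cs = length ts" "graft cs = c"
    "\<forall>i<length ts. dom (cs ! i) = childless (ts ! i)"
    using graft_exists[of c "\<lambda>i. childless (ts ! i)" "length ts"] by auto
  then obtain s where "map shape s = ts" "map coloring s = cs"
    using forest_surj[of cs ts] shape_coloring_surj by auto
  then show ?case using t cs by (intro exI[of _ "([], s)"]) (simp add: tree_of_def)
next
  case (Cons j w)
  obtain ts where t: "t = Node ts" by (cases t)
  have j: "j < length ts" and w: "w \<in> vertices (ts ! j)"
    using Cons.prems t by (auto simp: vertices_def)
  obtain cs where cs: "length cs = length ts" "graft cs = c"
    "\<forall>i<length ts. dom (cs ! i) = childless (ts ! i) - (if i = j then {w} else {})"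
    using graft_exists[OF Cons.prems(2)[unfolded t childless_remove_Cons[OF j]]] by blast
  obtain a where a: "map shape a = take j ts" "map coloring a = take j cs"
    using forest_surj[of "take j cs" "take j ts"] shape_coloring_surj cs j by auto
  obtain b where b: "map shape b = drop (Suc j) ts" "map coloring b = drop (Suc j) cs"
    using forest_surj[of "drop (Suc j) cs" "drop (Suc j) ts"] shape_coloring_surj cs j by auto
  obtain xs s where x: "tree_of (xs, s) = (ts ! j, w, cs ! j)"
    using Cons.IH[OF w, of "cs ! j"] cs j by auto
  have "length a = j" using arg_cong[OF a(1), of length] j by simp
  then show ?case using a b x t cs(1,2) j id_take_nth_drop[of j ts] id_take_nth_drop[of j cs]
    by (intro exI[of _ "((a, b) # xs, s)"]) (simp add: tree_of_def)
qed

section \<open>Edges, stem size and prefix edges of an encoded tree\<close>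

lemma finite_vertices [simp]: "finite (vertices t)"
  using finite_set[of "rl_preorder t"] by (simp only: set_rl_preorder)

text \<open>The map \<open>f\<close> allows for the offset in the indices of the children right of
  the stem.\<close>

lemma card_UN_Cons:
  assumes "finite I" "inj_on f I" "\<And>i. i \<in> I \<Longrightarrow> finite (A i)"
  shows "card (\<Union>i\<in>I. (#) (f i) ` A i) = (\<Sum>i\<in>I. card (A i))"
  using assms by (subst card_UN_disjoint) (auto simp: card_image inj_on_def)

text \<open>Represented by its lower endpoint, an edge of the tree is a vertex of some child
  subtree.\<close>

lemma card_edges_Node: "card (edges (Node ts)) = (\<Sum>t\<leftarrow>ts. card (vertices t))"
proof -
  have "edges (Node ts) = (\<Union>i<length ts. (#) i ` vertices (ts ! i))"
    by (auto simp: edges_def vertices_Node)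
  then show ?thesis
    using card_UN_Cons[of "{..<length ts}" "\<lambda>i. i" "\<lambda>i. vertices (ts ! i)"]
    by (simp add: sum_list_sum_nth atLeast0LessThan)
qed

lemma card_vertices: "card (vertices t) = Suc (card (edges t))"
proof -
  have "[] \<in> vertices t" by (simp add: vertices_def)
  then show ?thesis unfolding edges_def by (intro card.remove) simp
qed

lemma card_vertices_forest: "(\<Sum>t\<leftarrow>ts. card (vertices (shape t))) = forest_size ts"
  by (induction ts rule: forest_size.induct)
    (auto simp: card_vertices card_edges_Node comp_def)

lemma card_edges_stem_tree:
  "card (edges (stem_tree (xs, s))) =
     (\<Sum>(a, b)\<leftarrow>xs. Suc (forest_size a + forest_size b)) + forest_size s"
  by (induction "(xs, s)" arbitrary: xs rule: stem_tree.induct)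
    (auto simp: card_edges_Node card_vertices comp_def card_vertices_forest
      card_vertices_forest[unfolded card_vertices])

lemma stem_size_eq_length: "stem_size w = length w"
proof (induction w)
  case Nil
  then show ?case by (simp add: stem_size_def stem_edges_def)
next
  case (Cons j w)
  have "stem_edges (j # w) = insert [j] ((#) j ` stem_edges w)"
    by (auto simp: stem_edges_def prefix_Cons)
  moreover have "finite (stem_edges w)"
    by (rule finite_subset[of _ "set (prefixes w)"]) (auto simp: stem_edges_def)
  moreover have "[j] \<notin> (#) j ` stem_edges w" by (auto simp: stem_edges_def)
  ultimately show ?case using Cons by (simp add: stem_size_def card_image)
qed

text \<open>The first stem edge gives the \<open>Suc\<close>. Every vertex of a right sibling
  subtree counts, its root included, as the lower endpoint of an edge right of the stem; the left
  siblings contribute nothing.\<close>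

lemma card_prefix_edges_Node:
  "card (prefix_edges (Node (as @ t # bs)) (length as # w)) =
     Suc (card (prefix_edges t w)) + (\<Sum>t\<leftarrow>bs. card (vertices t))"
proof -
  let ?n = "length as"
  let ?S = "(#) ?n ` prefix_edges t w"
  let ?R = "\<Union>i<length bs. (#) (Suc (?n + i)) ` vertices (bs ! i)"
  have "prefix_edges (Node (as @ t # bs)) (?n # w) = insert [?n] ?S \<union> ?R" (is "?L = _")
  proof (rule set_eqI)
    fix v
    show "v \<in> ?L \<longleftrightarrow> v \<in> insert [?n] ?S \<union> ?R"
    proof (cases v)
      case Nil
      then show ?thesis by (auto simp: prefix_edges_def edges_def)
    next
      case (Cons i u)
      consider "i < ?n" | "i = ?n" | l where "i = Suc (?n + l)"
        by (metis less_imp_Suc_add linorder_neqE_nat)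
      then show ?thesis
        by cases (use Cons in \<open>auto simp: prefix_edges_def edges_def stem_edges_def
            vertices_def nth_append\<close>)
    qed
  qed
  moreover have "card (insert [?n] ?S \<union> ?R) = card (insert [?n] ?S) + card ?R"
    by (intro card_Un_disjoint) (auto simp: prefix_edges_def edges_def)
  moreover have "card (insert [?n] ?S) = Suc (card (prefix_edges t w))"
    by (subst card_insert_disjoint) (auto simp: prefix_edges_def edges_def card_image)
  moreover have "card ?R = (\<Sum>t\<leftarrow>bs. card (vertices t))"
    by (subst card_UN_Cons) (auto simp: inj_on_def sum_list_sum_nth atLeast0LessThan)
  ultimately show ?thesis by simp
qed

lemma card_prefix_edges_stem_tree:
  "card (prefix_edges (stem_tree (xs, s)) (stem_vertex (xs, s))) =
     (\<Sum>(a, b)\<leftarrow>xs. Suc (forest_size b))"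
proof (induction xs)
  case Nil
  then show ?case by (simp add: prefix_edges_def edges_def stem_edges_def)
next
  case (Cons ab xs)
  then show ?case
    using card_prefix_edges_Node[of "map shape (fst ab)" "stem_tree (xs, s)"]
    by (cases ab) (simp add: comp_def card_vertices_forest)
qed

lemma length_stem_vertex: "length (stem_vertex (xs, s)) = length xs"
  by (induction xs) auto

lemma bij_betw_tree_of: "bij_betw tree_of (codes n m k) (stemmed_trees n m k)"
proof (rule bij_betw_imageI)
  show "inj_on tree_of (codes n m k)" by (auto intro: inj_onI tree_of_inject)
  have "tree_of x \<in> stemmed_trees n m k \<longleftrightarrow> x \<in> codes n m k" for x
    by (cases x) (auto simp: tree_of_def stemmed_trees_def colored_doubly_rooted_trees_def
        codes_def stem_vertex_in_vertices dom_stem_coloring leaves_remove_eq_childless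
        stem_size_eq_length length_stem_vertex card_edges_stem_tree card_prefix_edges_stem_tree)
  moreover have "\<exists>x. y = tree_of x" if y: "y \<in> stemmed_trees n m k" for y
  proof -
    obtain t w c where "y = (t, w, c)" "w \<in> vertices t" "dom c = leaves t - {w}"
      using y by (auto simp: stemmed_trees_def colored_doubly_rooted_trees_def)
    then show ?thesis using tree_of_surj[of w t c] leaves_remove_eq_childless by metis
  qed
  ultimately show "tree_of ` codes n m k = stemmed_trees n m k" by blast
qed

theorem theorem3p9:
  fixes n m k :: nat
  assumes "k \<le> m" and "m \<le> n"
  shows "\<exists>f. bij_betw f (flawed_paths n m k) (stemmed_trees n m k)"
  using bij_betw_trans[OF bij_betw_inv_into[OF bij_betw_path_of] bij_betw_tree_of] by blast

end
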